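(* Let $A\in\mathbb{R}\setminus\{0\}$ and $B,a_0,b_0\in\mathbb{R}$ with $a_0+b_0=B$, and put $a(\epsilon)=a_0+\frac{A}{\epsilon}$, $b(\epsilon)=b_0-\frac{A}{\epsilon}$ for $\epsilon\in(0,1]$; assume $b(\epsilon)\ne0$ for all $\epsilon\in(0,1]$. Let $L>0$, let $0\neq\psi\in L^2(\mathbb{R},dx)$ have support contained in $[-L,L]$, let $p_0=\frac{\pi}{AL}$ and let $q_0\in\mathbb{R}$ satisfy $|q_0p_0|<2\pi$. Suppose there is a constant $\chi>0$ with $\sum_{n\in\mathbb{Z}}|\psi(x+nq_0)|^2=\chi$ for all $x\in\mathbb{R}$. Then for any $f\in L^2(\mathbb{R},dx)$ and $N_1,N_2,M_1,M_2\in\mathbb{Z}$, $$\lim_{\epsilon\to0^+}\sum_{n=N_1}^{N_2}\sum_{m=M_1}^{M_2}\frac{\epsilon}{2\chi\sinh(\epsilon L)}\langle\psi^{\epsilon,a(\epsilon),b(\epsilon)}_{(n,m)}|f\rangle\,|\psi^{\epsilon,a(\epsilon),b(\epsilon)}_{(n,m)}\rangle=\sum_{n=N_1}^{N_2}\sum_{m=M_1}^{M_2}\frac{1}{2\chi L}\langle\psi^{A,B}_{(n,m)}|f\rangle\,|\psi^{A,B}_{(n,m)}\rangle,$$ where the limit holds in $L^2(\mathbb{R},dx)$ and pointwise.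
   Context: Inner products are linear in the second argument. Heisenberg side: $\eta^{A,B}$ is the representation on $L^2(\mathbb{R})$ of the Heisenberg group $H$ ($\mathbb{R}\times\mathbb{R}^2$ with product $(x_1,(y_1,z_1))(x_2,(y_2,z_2))=(x_1+x_2,(y_1+y_2+x_1z_2,z_1+z_2))$) given by $(\eta^{A,B}(c,(v_1,v_2))f)(x)=e^{i[A(v_1+xv_2)+Bv_2]}f(c+x)$, and $|\psi^{A,B}_{(n,m)}\rangle=\eta^{A,B}\big(nq_0,(\tfrac{nq_0mp_0}{2},mp_0)\big)\psi$. Extended affine side: for $\epsilon\in(0,1]$, $a\in\mathbb{R}$, $b\ne0$, $\rho_\epsilon^{a,b}$ is the representation on $L^2(\mathbb{R})$ of $EA=\mathbb{R}^+\times\mathbb{R}\times\mathbb{R}$ (product $(\alpha,\beta,\gamma)(x,y,z)=(\alpha x,\alpha y+\beta,\gamma+z)$) given by $(\rho_\epsilon^{a,b}(\alpha,\beta,\gamma)f)(x)=e^{ia\gamma}e^{ib\beta e^{-\epsilon x}}f\big(x-\tfrac{\log\alpha}{\epsilon}\big)$. Put $\alpha_n(\epsilon)=e^{-\epsilon nq_0}$, $\beta_{mn}(\epsilon)=-\frac{2\pi m\,e^{-\epsilon nq_0}}{b(\epsilon)(e^{\epsilon L}-e^{-\epsilon L})}$, $\gamma_{mn}(\epsilon)=\beta_{mn}(\epsilon)\frac{\ln\alpha_n(\epsilon)}{\alpha_n(\epsilon)-1}$ (the quotient is $1$ when $\alpha_n(\epsilon)=1$), $Q_\epsilon(x)=e^{-\frac12\epsilon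 x}$, and $|\psi^{\epsilon,a(\epsilon),b(\epsilon)}_{(n,m)}\rangle=\rho_\epsilon^{a(\epsilon),b(\epsilon)}(\alpha_n(\epsilon),\beta_{mn}(\epsilon),\gamma_{mn}(\epsilon))(Q_\epsilon\psi)$. In the pointwise statement, $\psi$ is a fixed function and the representations act by the displayed formulas. *)

theory Defs
  imports "HOL-Analysis.Analysis"
begin

text \<open>
  Elements of \<open>L\<^sup>2(\<real>, dx)\<close> are represented by functions; identities between elements of
  \<open>L\<^sup>2\<close> are understood almost everywhere.
\<close>

definition L2 :: "(real \<Rightarrow> complex) set" where
  "L2 = {f. f \<in> borel_measurable lebesgue \<and> integrable lebesgue (\<lambda>x. (norm (f x))\<^sup>2)}"

definition L2_inner :: "(real \<Rightarrow> complex) \<Rightarrow> (real \<Rightarrow> complex) \<Rightarrow> complex" where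
  "L2_inner f g = (LINT x|lebesgue. cnj (f x) * g x)"

definition norm_L2 :: "(real \<Rightarrow> complex) \<Rightarrow> real" where
  "norm_L2 f = sqrt (LINT x|lebesgue. (norm (f x))\<^sup>2)"

text \<open>
  Membership in \<open>L2\<close> is part of the definition, because the Bochner integral of a
  non-integrable function is \<open>0\<close> and so \<open>norm_L2\<close> is meaningless outside \<open>L2\<close>.
\<close>

definition tendsto_L2 :: "('a \<Rightarrow> real \<Rightarrow> complex) \<Rightarrow> (real \<Rightarrow> complex) \<Rightarrow> 'a filter \<Rightarrow> bool" where
  "tendsto_L2 S T F \<longleftrightarrow>
     (\<forall>\<^sub>F e in F. S e \<in> L2) \<and> T \<in> L2 \<and> ((\<lambda>e. norm_L2 (\<lambda>x. S e x - T x)) \<longlongrightarrow> 0) F"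


subsection \<open>Heisenberg group\<close>

type_synonym heis = "real \<times> real \<times> real"

fun heis_mult :: "heis \<Rightarrow> heis \<Rightarrow> heis" where
  "heis_mult (x1, y1, z1) (x2, y2, z2) = (x1 + x2, y1 + y2 + x1 * z2, z1 + z2)"

fun eta :: "real \<Rightarrow> real \<Rightarrow> heis \<Rightarrow> (real \<Rightarrow> complex) \<Rightarrow> real \<Rightarrow> complex" where
  "eta A B (c, v1, v2) f x = exp (\<i> * of_real (A * (v1 + x * v2) + B * v2)) * f (c + x)"

lemma eta_mult: "eta A B (heis_mult g h) f = eta A B g (eta A B h f)"
proof
  fix x
  obtain c v1 v2 d w1 w2 where [simp]: "g = (c, v1, v2)" "h = (d, w1, w2)"
    by (metis prod_cases3)
  show "eta A B (heis_mult g h) f x = eta A B g (eta A B h f) x"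
    by (simp add: mult.assoc [symmetric] exp_add [symmetric]) (simp add: algebra_simps)
qed

definition psi_heis ::
    "real \<Rightarrow> real \<Rightarrow> real \<Rightarrow> real \<Rightarrow> (real \<Rightarrow> complex) \<Rightarrow> int \<Rightarrow> int \<Rightarrow> real \<Rightarrow> complex" where
  "psi_heis A B q0 p0 \<psi> n m =
     eta A B (of_int n * q0, (of_int n * q0 * (of_int m * p0)) / 2, of_int m * p0) \<psi>"


subsection \<open>Extended affine group\<close>

text \<open>The first component of an element of the group is required to be positive.\<close>

type_synonym ext_aff = "real \<times> real \<times> real"

fun ea_mult :: "ext_aff \<Rightarrow> ext_aff \<Rightarrow> ext_aff" where
  "ea_mult (\<alpha>, \<beta>, \<gamma>) (x, y, z) = (\<alpha> * x, \<alpha> * y + \<beta>, \<gamma> + z)"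

fun rho :: "real \<Rightarrow> real \<Rightarrow> real \<Rightarrow> ext_aff \<Rightarrow> (real \<Rightarrow> complex) \<Rightarrow> real \<Rightarrow> complex" where
  "rho \<epsilon> a b (\<alpha>, \<beta>, \<gamma>) f x =
     exp (\<i> * of_real (a * \<gamma>)) * exp (\<i> * of_real (b * \<beta> * exp (- \<epsilon> * x))) * f (x - ln \<alpha> / \<epsilon>)"

lemma rho_mult:
  assumes "\<epsilon> > 0" "fst g > 0" "fst h > 0"
  shows "rho \<epsilon> a b (ea_mult g h) f = rho \<epsilon> a b g (rho \<epsilon> a b h f)"
proof
  fix x
  obtain \<alpha> \<beta> \<gamma> \<alpha>' \<beta>' \<gamma>' where [simp]: "g = (\<alpha>, \<beta>, \<gamma>)" "h = (\<alpha>', \<beta>', \<gamma>')"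
    by (metis prod_cases3)
  have "exp (- \<epsilon> * (x - ln \<alpha> / \<epsilon>)) = exp (- \<epsilon> * x + ln \<alpha>)"
    using assms by (simp add: field_simps)
  also have "\<dots> = \<alpha> * exp (- \<epsilon> * x)"
    using assms by (simp only: exp_add) simp
  finally have e: "exp (- \<epsilon> * (x - ln \<alpha> / \<epsilon>)) = \<alpha> * exp (- \<epsilon> * x)" .
  have l: "x - ln (\<alpha> * \<alpha>') / \<epsilon> = x - ln \<alpha> / \<epsilon> - ln \<alpha>' / \<epsilon>"
    using assms by (simp add: ln_mult add_divide_distrib)
  show "rho \<epsilon> a b (ea_mult g h) f x = rho \<epsilon> a b g (rho \<epsilon> a b h f) x"
    by (simp only: \<open>g = _\<close> \<open>h = _\<close> ea_mult.simps rho.simps e l)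
       (simp add: algebra_simps exp_add)
qed

definition alpha_n :: "real \<Rightarrow> int \<Rightarrow> real \<Rightarrow> real" where
  "alpha_n q0 n \<epsilon> = exp (- \<epsilon> * of_int n * q0)"

definition beta_mn :: "(real \<Rightarrow> real) \<Rightarrow> real \<Rightarrow> real \<Rightarrow> int \<Rightarrow> int \<Rightarrow> real \<Rightarrow> real" where
  "beta_mn b L q0 m n \<epsilon> =
     - (2 * pi * of_int m * exp (- \<epsilon> * of_int n * q0) / (b \<epsilon> * (exp (\<epsilon> * L) - exp (- \<epsilon> * L))))"

definition gamma_mn :: "(real \<Rightarrow> real) \<Rightarrow> real \<Rightarrow> real \<Rightarrow> int \<Rightarrow> int \<Rightarrow> real \<Rightarrow> real" where
  "gamma_mn b L q0 m n \<epsilon> =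
     beta_mn b L q0 m n \<epsilon> *
       (if alpha_n q0 n \<epsilon> = 1 then 1 else ln (alpha_n q0 n \<epsilon>) / (alpha_n q0 n \<epsilon> - 1))"

definition Q :: "real \<Rightarrow> real \<Rightarrow> real" where
  "Q \<epsilon> x = exp (- (1 / 2) * \<epsilon> * x)"

definition psi_ea ::
    "(real \<Rightarrow> real) \<Rightarrow> (real \<Rightarrow> real) \<Rightarrow> real \<Rightarrow> real \<Rightarrow> (real \<Rightarrow> complex) \<Rightarrow> real \<Rightarrow>
      int \<Rightarrow> int \<Rightarrow> real \<Rightarrow> complex" where
  "psi_ea a b L q0 \<psi> \<epsilon> n m =
     rho \<epsilon> (a \<epsilon>) (b \<epsilon>) (alpha_n q0 n \<epsilon>, beta_mn b L q0 m n \<epsilon>, gamma_mn b L q0 m n \<epsilon>)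
       (\<lambda>x. of_real (Q \<epsilon> x) * \<psi> x)"

end

theory Submission
  imports Defs "HOL-Real_Asymp.Real_Asymp"
begin

text \<open>
  Both families are phases times the same translate of \<open>\<psi>\<close>, apart from the factor
  \<open>Q \<epsilon>\<close>, which tends to \<open>1\<close> and is at most \<open>exp (L / 2)\<close> on the support of \<open>\<psi>\<close>.
  In the affine phase \<open>b \<beta> (exp (- \<epsilon> x) + (a / b) (\<gamma> / \<beta>))\<close> the prefactor is of
  order \<open>1 / \<epsilon>\<close>; as \<open>a / b = - 1 - B \<epsilon> / A + o(\<epsilon>)\<close> and \<open>\<gamma> / \<beta> = 1 + \<epsilon> n q\<^sub>0 / 2 + o(\<epsilon>)\<close>,
  the terms of order \<open>0\<close> in the bracket cancel and those of order \<open>1\<close> give the Heisenberg phase.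
  Hence there is pointwise convergence with a square-integrable bound uniform in \<open>\<epsilon>\<close>, and dominated
  convergence gives the limits of the inner products and of the \<open>L\<^sup>2\<close> norm.
\<close>

section \<open>Square integrability and dominated convergence from the right\<close>

text \<open>The product is dominated by \<open>(g x)\<^sup>2 + (h x)\<^sup>2\<close>. This serves
  both for the inner products and for the cross terms in the square of a finite sum.\<close>

lemma integrable_mult_of_square_integrable:
  fixes g h :: "'a \<Rightarrow> real"
  assumes [measurable]: "g \<in> borel_measurable M" "h \<in> borel_measurable M"
    and "integrable M (\<lambda>x. (g x)\<^sup>2)" "integrable M (\<lambda>x. (h x)\<^sup>2)"
  shows "integrable M (\<lambda>x. g x * h x)"
proof (rule Bochner_Integration.integrable_bound)
  show "integrable M (\<lambda>x. (g x)\<^sup>2 + (h x)\<^sup>2)"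
    using assms by simp
  have "\<bar>g x * h x\<bar> \<le> (g x)\<^sup>2 + (h x)\<^sup>2" for x
    using zero_le_power2[of "\<bar>g x\<bar> - \<bar>h x\<bar>"] zero_le_mult_iff[of "\<bar>g x\<bar>" "\<bar>h x\<bar>"]
    unfolding power2_diff abs_mult power2_abs by linarith
  then show "AE x in M. norm (g x * h x) \<le> norm ((g x)\<^sup>2 + (h x)\<^sup>2)"
    by simp
qed simp

lemma square_integrable_sum:
  fixes h :: "'i \<Rightarrow> 'a \<Rightarrow> real"
  assumes "\<And>i. i \<in> I \<Longrightarrow> h i \<in> borel_measurable M"
    and "\<And>i. i \<in> I \<Longrightarrow> integrable M (\<lambda>x. (h i x)\<^sup>2)"
  shows "integrable M (\<lambda>x. (\<Sum>i\<in>I. h i x)\<^sup>2)"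
  unfolding power2_eq_square sum_product
  using assms
  by (intro Bochner_Integration.integrable_sum integrable_mult_of_square_integrable)
     (auto simp: power2_eq_square)

text \<open>The eventual hypotheses hold on some interval \<open>(c, d)\<close>, and the limit from
  the right may be tested on sequences in that interval, where the sequential dominated convergence
  theorem applies. The null set in the bound may vary with \<open>e\<close>.\<close>

lemma tendsto_integral_dominated_at_right:
  fixes F :: "real \<Rightarrow> 'a \<Rightarrow> 'b::{banach, second_countable_topology}"
  assumes ev: "\<forall>\<^sub>F e in at_right c. F e \<in> borel_measurable M \<and> (AE x in M. norm (F e x) \<le> w x)"
    and f: "f \<in> borel_measurable M" and w: "integrable M w"
    and lim: "AE x in M. ((\<lambda>e. F e x) \<longlongrightarrow> f x) (at_right c)"
  shows "((\<lambda>e. LINT x|M. F e x) \<longlongrightarrow> (LINT x|M. f x)) (at_right c)"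
proof -
  obtain d where d: "c < d"
    and F: "\<And>e. c < e \<Longrightarrow> e < d \<Longrightarrow> F e \<in> borel_measurable M"
    and bound: "\<And>e. c < e \<Longrightarrow> e < d \<Longrightarrow> AE x in M. norm (F e x) \<le> w x"
    using ev unfolding eventually_at_right_field by blast
  show ?thesis
  proof (rule tendsto_at_right_sequentially[OF d])
    fix s :: "nat \<Rightarrow> real"
    assume s: "\<And>n. c < s n" "\<And>n. s n < d" "s \<longlonglongrightarrow> c"
    then have right: "filterlim s (at_right c) sequentially"
      by (simp add: filterlim_at less_imp_neq[symmetric])
    show "(\<lambda>n. LINT x|M. F (s n) x) \<longlonglongrightarrow> (LINT x|M. f x)"
    proof (rule integral_dominated_convergence[OF f _ w])
      show "AE x in M. (\<lambda>n. F (s n) x) \<longlonglongrightarrow> f x"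
        using lim by eventually_elim (rule filterlim_compose[OF _ right])
    qed (use F bound s in auto)
  qed
qed

text \<open>The squared distance \<open>(norm (S e x - T x))\<^sup>2\<close> tends to
  \<open>0\<close> pointwise and is dominated by a multiple of \<open>(g x)\<^sup>2\<close>.
  Membership of \<open>T\<close> in \<open>L2\<close> is a conclusion, since \<open>T\<close>
  inherits measurability and the bound from \<open>S\<close>.\<close>

lemma tendsto_L2_dominated:
  fixes c :: real
  assumes ev: "\<forall>\<^sub>F e in at_right c. S e \<in> borel_measurable lebesgue \<and>
      (AE x in lebesgue. norm (S e x) \<le> g x)"
    and g [measurable]: "g \<in> borel_measurable lebesgue"
    and g2: "integrable lebesgue (\<lambda>x. (g x)\<^sup>2)"
    and lim: "\<And>x. ((\<lambda>e. S e x) \<longlongrightarrow> T x) (at_right c)"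
  shows "tendsto_L2 S T (at_right c)"
proof -
  obtain d where d: "c < d"
    and S: "\<And>e. c < e \<Longrightarrow> e < d \<Longrightarrow> S e \<in> borel_measurable lebesgue"
    and bound: "\<And>e. c < e \<Longrightarrow> e < d \<Longrightarrow> AE x in lebesgue. norm (S e x) \<le> g x"
    using ev unfolding eventually_at_right_field by blast
  \<comment> \<open>Any sequence in the open interval that tends to \<open>c\<close> will do; the
    summand \<open>2\<close> keeps \<open>s 0\<close> strictly below \<open>d\<close>.\<close>
  define s where "s = (\<lambda>n::nat. c + (d - c) / (real n + 2))"
  have s: "c < s n" "s n < d" for n
    using d divide_strict_left_mono[of 1 "real n + 2" "d - c"] by (simp_all add: s_def)
  have "s \<longlonglongrightarrow> c"
    unfolding s_def by real_asymp
  with s have right: "filterlim s (at_right c) sequentially"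
    by (simp add: filterlim_at less_imp_neq[symmetric])
  have lim_s: "(\<lambda>n. S (s n) x) \<longlonglongrightarrow> T x" for x
    by (rule filterlim_compose[OF lim right])
  have T [measurable]: "T \<in> borel_measurable lebesgue"
    using S s by (intro borel_measurable_LIMSEQ_metric[OF _ lim_s]) auto
  have in_L2: "h \<in> L2" if [measurable]: "h \<in> borel_measurable lebesgue"
    and h: "AE x in lebesgue. norm (h x) \<le> g x" for h
    unfolding L2_def
  proof (intro CollectI conjI that Bochner_Integration.integrable_bound[OF g2])
    show "AE x in lebesgue. norm ((norm (h x))\<^sup>2) \<le> norm ((g x)\<^sup>2)"
      using h by eventually_elim (simp add: power_mono)
  qed simp
  \<comment> \<open>The exceptional set depends on the parameter, so a common null set is available
    only along countably many parameters; a sequence is enough to pass the bound to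
    \<open>T\<close>.\<close>
  have "AE x in lebesgue. \<forall>n. norm (S (s n) x) \<le> g x"
    using bound s by (simp add: AE_all_countable)
  then have T_bound: "AE x in lebesgue. norm (T x) \<le> g x"
    by eventually_elim (rule tendsto_upperbound[OF tendsto_norm[OF lim_s]], auto)
  have "((\<lambda>e. LINT x|lebesgue. (norm (S e x - T x))\<^sup>2) \<longlongrightarrow> (LINT (x::real)|lebesgue. 0))
      (at_right c)"
  proof (rule tendsto_integral_dominated_at_right)
    show "\<forall>\<^sub>F e in at_right c. (\<lambda>x. (norm (S e x - T x))\<^sup>2) \<in> borel_measurable lebesgue \<and>
        (AE x in lebesgue. norm ((norm (S e x - T x))\<^sup>2) \<le> 4 * (g x)\<^sup>2)"
      using ev
    proof (eventually_elim, intro conjI)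
      fix e
      assume *: "S e \<in> borel_measurable lebesgue \<and> (AE x in lebesgue. norm (S e x) \<le> g x)"
      then have [measurable]: "S e \<in> borel_measurable lebesgue" by blast
      show "(\<lambda>x. (norm (S e x - T x))\<^sup>2) \<in> borel_measurable lebesgue"
        by measurable
      show "AE x in lebesgue. norm ((norm (S e x - T x))\<^sup>2) \<le> 4 * (g x)\<^sup>2"
        using conjunct2[OF *] T_bound
      proof eventually_elim
        case (elim x)
        have "norm (S e x - T x) \<le> 2 * g x"
          using norm_triangle_ineq4[of "S e x" "T x"] elim by linarith
        from power_mono[OF this, of 2] show ?case by (simp add: power_mult_distrib)
      qed
    qed
    show "AE x in lebesgue. ((\<lambda>e. (norm (S e x - T x))\<^sup>2) \<longlongrightarrow> 0) (at_right c)"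
      using lim by (intro AE_I2) (auto intro!: tendsto_eq_intros)
  qed (use g2 in simp_all)
  from tendsto_real_sqrt[OF this] have "((\<lambda>e. norm_L2 (\<lambda>x. S e x - T x)) \<longlongrightarrow> 0) (at_right c)"
    by (simp add: norm_L2_def)
  moreover have "\<forall>\<^sub>F e in at_right c. S e \<in> L2"
    using ev by eventually_elim (blast intro: in_L2)
  moreover have "T \<in> L2"
    using T T_bound by (rule in_L2)
  ultimately show ?thesis by (simp add: tendsto_L2_def)
qed

section \<open>Translations, and both families as phases times translates\<close>

lemma measurable_shift_lebesgue: "(\<lambda>x::real. c + x) \<in> lebesgue \<rightarrow>\<^sub>M lebesgue"
  using lebesgue_affine_measurable[of "\<lambda>_. 1" c] by simp

text \<open>Lebesgue measure is its own image under a translation. This carries the support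
  condition on \<open>\<psi>\<close> over to its translates.\<close>

lemma AE_lebesgue_shift:
  assumes "AE x in lebesgue. P (x :: real)"
  shows "AE x in lebesgue. P (c + x)"
proof (rule AE_distrD[OF measurable_shift_lebesgue])
  have "distr lebesgue lebesgue (\<lambda>x. c + x) = lebesgue"
    using lebesgue_real_affine[of 1 c] by (simp add: density_1)
  then show "AE x in distr lebesgue lebesgue (\<lambda>x. c + x). P x"
    by (simp only: assms)
qed

lemma L2_shift:
  assumes "f \<in> L2"
  shows "(\<lambda>x. f (c + x)) \<in> L2"
  using assms lebesgue_integrable_real_affine[of "\<lambda>x. (norm (f x))\<^sup>2" 1 c]
    measurable_compose[OF measurable_shift_lebesgue[of c], of f borel]
  by (simp add: L2_def)

text \<open>As \<open>ln (alpha_n q0 n \<epsilon>) = - \<epsilon> * n * q0\<close>, the affine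
  translation is by exactly \<open>n * q0\<close> for every \<open>\<epsilon>\<close>, as on the
  Heisenberg side. Only the phase and the weight depend on \<open>\<epsilon>\<close>.\<close>

lemma psi_ea_eq:
  assumes "\<epsilon> > 0"
  shows "psi_ea a b L q0 \<psi> \<epsilon> n m x =
    cis (a \<epsilon> * gamma_mn b L q0 m n \<epsilon> + b \<epsilon> * beta_mn b L q0 m n \<epsilon> * exp (- \<epsilon> * x)) *
    of_real (exp (- (1 / 2) * \<epsilon> * (of_int n * q0 + x))) * \<psi> (of_int n * q0 + x)"
proof -
  have "x - ln (alpha_n q0 n \<epsilon>) / \<epsilon> = of_int n * q0 + x"
    using assms by (simp add: alpha_n_def)
  then show ?thesis
    by (simp only: psi_ea_def rho.simps Q_def) (simp only: cis_conv_exp exp_add[symmetric]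
      of_real_add distrib_left mult.assoc)
qed

lemma psi_heis_eq:
  "psi_heis A B q0 p0 \<psi> n m x =
    cis (of_int m * p0 * (A * (of_int n * q0 / 2 + x) + B)) * \<psi> (of_int n * q0 + x)"
  by (simp add: psi_heis_def cis_conv_exp algebra_simps)

section \<open>Asymptotics of the affine phase\<close>

text \<open>With \<open>v = e * u\<close> this is the expansion
  \<open>v / (1 - exp (- v)) = 1 + v / 2 + O(v^2)\<close>. It is the first-order behaviour of the
  ratio of \<open>gamma_mn\<close> to \<open>beta_mn\<close>.\<close>

lemma gamma_quotient_expansion:
  fixes u :: real
  defines "g \<equiv> (\<lambda>e. if exp (- e * u) = 1 then 1 else ln (exp (- e * u)) / (exp (- e * u) - 1))"
  shows "((\<lambda>e. (g e - 1) / e) \<longlongrightarrow> u / 2) (at_right 0)"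
proof (cases "u = 0")
  case False
  have "((\<lambda>v::real. ((- v) / (exp (- v) - 1) - 1) / v) \<longlongrightarrow> 1 / 2) (at 0)"
    by real_asymp
  moreover have "filterlim (\<lambda>e. e * u) (at 0) (at_right 0)"
  proof (rule filterlim_atI)
    show "((\<lambda>e. e * u) \<longlongrightarrow> 0) (at_right 0)"
      by (auto intro!: tendsto_eq_intros)
    show "\<forall>\<^sub>F e in at_right 0. e * u \<noteq> 0"
      using eventually_at_right_less[of "0::real"] by eventually_elim (use False in simp)
  qed
  ultimately have "((\<lambda>e. ((- (e * u)) / (exp (- (e * u)) - 1) - 1) / (e * u)) \<longlongrightarrow> 1 / 2) (at_right 0)"
    by (rule filterlim_compose)
  from tendsto_mult_right[OF this, of u]
  have "((\<lambda>e. ((- e * u) / (exp (- e * u) - 1) - 1) / e) \<longlongrightarrow> u / 2) (at_right 0)"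
    using False by simp
  moreover have "\<forall>\<^sub>F e in at_right 0.
      ((- e * u) / (exp (- e * u) - 1) - 1) / e = (g e - 1) / e"
    using eventually_at_right_less[of "0::real"]
    by eventually_elim (use False in \<open>simp add: g_def\<close>)
  ultimately show ?thesis by (rule Lim_transform_eventually)
\<comment> \<open>For \<open>u = 0\<close> the default value \<open>1\<close> is taken for every
  \<open>e\<close>, so the difference quotient is constantly \<open>0\<close>.\<close>
qed (simp add: g_def)

lemma phase_tendsto:
  fixes A B a0 b0 L :: real
  assumes A: "A \<noteq> 0" and B: "a0 + b0 = B"
    and a: "\<And>\<epsilon>. \<epsilon> \<in> {0<..1} \<Longrightarrow> a \<epsilon> = a0 + A / \<epsilon>"
    and b: "\<And>\<epsilon>. \<epsilon> \<in> {0<..1} \<Longrightarrow> b \<epsilon> = b0 - A / \<epsilon>"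
    and b_nz: "\<And>\<epsilon>. \<epsilon> \<in> {0<..1} \<Longrightarrow> b \<epsilon> \<noteq> 0"
    and L: "L > 0"
  shows "((\<lambda>\<epsilon>. a \<epsilon> * gamma_mn b L q0 m n \<epsilon> + b \<epsilon> * beta_mn b L q0 m n \<epsilon> * exp (- \<epsilon> * x))
    \<longlongrightarrow> of_int m * (pi / (A * L)) * (A * (of_int n * q0 / 2 + x) + B)) (at_right 0)"
proof -
  define u where "u = of_int n * q0"
  define g where
    "g = (\<lambda>e. if exp (- e * u) = 1 then 1 else ln (exp (- e * u)) / (exp (- e * u) - 1))"
  \<comment> \<open>The prefactor \<open>b e * beta_mn b L q0 m n e\<close> is
    \<open>- 2 * pi * m * W e / e\<close>, so \<open>W\<close> is its part with a finite limit.
    Likewise \<open>r\<close> is \<open>a / b\<close> with numerator and denominator multiplied by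
    \<open>e\<close>.\<close>
  define W where "W = (\<lambda>e. exp (- e * u) * e / (exp (e * L) - exp (- e * L)))"
  define r where "r = (\<lambda>e. (a0 * e + A) / (b0 * e - A))"
  have W: "(W \<longlongrightarrow> 1 / (2 * L)) (at_right 0)"
  proof -
    have "(W \<longlongrightarrow> inverse L / 2) (at_right 0)"
      unfolding W_def using L by real_asymp
    moreover have "inverse L / 2 = 1 / (2 * L)"
      by (simp add: field_simps)
    ultimately show ?thesis by simp
  qed
  have r: "(r \<longlongrightarrow> - 1) (at_right 0)"
    unfolding r_def using A by (auto intro!: tendsto_eq_intros)
  have g: "((\<lambda>e. (g e - 1) / e) \<longlongrightarrow> u / 2) (at_right 0)"
    unfolding g_def by (rule gamma_quotient_expansion)
  have x: "((\<lambda>e. (exp (- e * x) - 1) / e) \<longlongrightarrow> - x) (at_right 0)"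
    by real_asymp
  have B_lim: "((\<lambda>e. B / (b0 * e - A)) \<longlongrightarrow> - B / A) (at_right 0)"
    using A by (auto intro!: tendsto_eq_intros)
  \<comment> \<open>The factor \<open>1 / e\<close> is distributed over the bracket
    \<open>exp (- e * x) + r e * g e\<close>, rewritten as
    \<open>(exp (- e * x) - 1) + r e * (g e - 1) + (r e + 1)\<close>; each summand divided by
    \<open>e\<close> converges.\<close>
  have lim: "((\<lambda>e. - (2 * pi * of_int m) * W e *
      ((exp (- e * x) - 1) / e + r e * ((g e - 1) / e) + B / (b0 * e - A)))
    \<longlongrightarrow> - (2 * pi * of_int m) * (1 / (2 * L)) * (- x + (- 1) * (u / 2) + (- B / A))) (at_right 0)"
    by (intro tendsto_intros W r g x B_lim)
  have limit: "- (2 * pi * of_int m) * (1 / (2 * L)) * (- x + (- 1) * (u / 2) + (- B / A)) =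
      of_int m * (pi / (A * L)) * (A * (of_int n * q0 / 2 + x) + B)"
    using A L by (simp add: u_def field_simps)
  have ev: "\<forall>\<^sub>F e in at_right 0. - (2 * pi * of_int m) * W e *
      ((exp (- e * x) - 1) / e + r e * ((g e - 1) / e) + B / (b0 * e - A)) =
      a e * gamma_mn b L q0 m n e + b e * beta_mn b L q0 m n e * exp (- e * x)"
    using eventually_at_right_real[OF zero_less_one]
  proof eventually_elim
    case (elim e)
    then have e: "e > 0" "e \<noteq> 0" "e \<in> {0<..1}" by auto
    have be: "b e * e = b0 * e - A" and ae: "a e * e = a0 * e + A"
      using e by (auto simp: a b field_simps)
    have nz: "b0 * e - A \<noteq> 0"
      using b_nz[OF e(3)] e be by (metis mult_eq_0_iff)
    have D: "exp (e * L) - exp (- e * L) \<noteq> 0"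
      using e L by (simp add: mult_less_0_iff)
    define c where "c = - (2 * pi * of_int m) * (W e / e)"
    have bb: "b e * beta_mn b L q0 m n e = c"
      using e b_nz[OF e(3)] D by (simp add: c_def beta_mn_def W_def u_def field_simps)
    have re: "r e = a e / b e"
      using e by (simp add: r_def be[symmetric] ae[symmetric])
    have gg: "gamma_mn b L q0 m n e = beta_mn b L q0 m n e * g e"
      by (simp add: gamma_mn_def g_def alpha_n_def u_def mult.assoc)
    have ag: "a e * gamma_mn b L q0 m n e = c * (r e * g e)"
      using b_nz[OF e(3)] by (simp add: gg re bb[symmetric])
    \<comment> \<open>In \<open>r e + 1\<close> the terms \<open>A\<close> and \<open>- A\<close>
      cancel, and \<open>a0 + b0 = B\<close> leaves \<open>B * e\<close> in the numerator.\<close>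
    have rB: "B / (b0 * e - A) = (r e + 1) / e"
      using nz e by (simp add: r_def B[symmetric] field_simps)
    have "- (2 * pi * of_int m) * W e *
        ((exp (- e * x) - 1) / e + r e * ((g e - 1) / e) + B / (b0 * e - A)) =
        c * (r e * g e + exp (- e * x))"
      unfolding rB c_def using e(2) by (simp add: field_simps)
    then show ?case unfolding ag bb by (simp add: distrib_left)
  qed
  from Lim_transform_eventually[OF lim ev] show ?thesis
    unfolding limit .
qed

section \<open>Convergence of vectors and coefficients, and the finite sums\<close>

theorem mainTheorem12:
  fixes A B a0 b0 L p0 q0 chi :: real
    and a b :: "real \<Rightarrow> real"
    and \<psi> f :: "real \<Rightarrow> complex"
    and N1 N2 M1 M2 :: int
  assumes "A \<noteq> 0"
    and "a0 + b0 = B"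
    and "\<And>\<epsilon>. \<epsilon> \<in> {0<..1} \<Longrightarrow> a \<epsilon> = a0 + A / \<epsilon>"
    and "\<And>\<epsilon>. \<epsilon> \<in> {0<..1} \<Longrightarrow> b \<epsilon> = b0 - A / \<epsilon>"
    and "\<And>\<epsilon>. \<epsilon> \<in> {0<..1} \<Longrightarrow> b \<epsilon> \<noteq> 0"
    and "L > 0"
    and "\<psi> \<in> L2"
    and "\<not> (AE x in lebesgue. \<psi> x = 0)"
    and "AE x in lebesgue. x \<notin> {-L..L} \<longrightarrow> \<psi> x = 0"
    and "p0 = pi / (A * L)"
    and "\<bar>q0 * p0\<bar> < 2 * pi"
    and "chi > 0"
    and "\<And>x. ((\<lambda>n::int. (norm (\<psi> (x + of_int n * q0)))\<^sup>2) has_sum chi) UNIV"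
    and "f \<in> L2"
  shows "let
      S = (\<lambda>\<epsilon> x. \<Sum>n=N1..N2. \<Sum>m=M1..M2.
        of_real (\<epsilon> / (2 * chi * sinh (\<epsilon> * L))) *
          L2_inner (psi_ea a b L q0 \<psi> \<epsilon> n m) f * psi_ea a b L q0 \<psi> \<epsilon> n m x);
      T = (\<lambda>x. \<Sum>n=N1..N2. \<Sum>m=M1..M2.
        of_real (1 / (2 * chi * L)) *
          L2_inner (psi_heis A B q0 p0 \<psi> n m) f * psi_heis A B q0 p0 \<psi> n m x)
    in tendsto_L2 S T (at_right 0) \<and> (\<forall>x. ((\<lambda>\<epsilon>. S \<epsilon> x) \<longlongrightarrow> T x) (at_right 0))"
proof -
  \<comment> \<open>Coefficients and vectors are indexed by pairs, which turns the double sum into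
    one sum over a finite set.\<close>
  define C where "C = (\<lambda>(n, m) \<epsilon>. complex_of_real (\<epsilon> / (2 * chi * sinh (\<epsilon> * L))) *
    L2_inner (psi_ea a b L q0 \<psi> \<epsilon> n m) f)"
  define D where "D = (\<lambda>(n, m). complex_of_real (1 / (2 * chi * L)) *
    L2_inner (psi_heis A B q0 p0 \<psi> n m) f)"
  define \<phi> where "\<phi> = (\<lambda>(n, m) \<epsilon>. psi_ea a b L q0 \<psi> \<epsilon> n m)"
  define h where "h = (\<lambda>(n, m). psi_heis A B q0 p0 \<psi> n m)"
  \<comment> \<open>Phases have modulus \<open>1\<close>, and for \<open>0 < \<epsilon> < 1\<close>
    the weight \<open>exp (- \<epsilon> * y / 2)\<close> is at most \<open>exp (L / 2)\<close> when
    \<open>y \<ge> - L\<close>. So \<open>v\<close> bounds the affine vectors uniformly in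
    \<open>\<epsilon>\<close>.\<close>
  define v where "v = (\<lambda>(n::int, m::int) x. exp (L / 2) * norm (\<psi> (of_int n * q0 + x)))"
  let ?I = "{N1..N2} \<times> {M1..M2}"
  have L: "L > 0" and chi: "chi > 0" by fact+
  have [measurable]: "f \<in> borel_measurable lebesgue" and f2: "integrable lebesgue (\<lambda>x. (norm (f x))\<^sup>2)"
    using \<open>f \<in> L2\<close> by (auto simp: L2_def)
  have shift_meas [measurable]: "(\<lambda>x. \<psi> (c + x)) \<in> borel_measurable lebesgue"
    and shift_sq: "integrable lebesgue (\<lambda>x. (norm (\<psi> (c + x)))\<^sup>2)" for c
    using L2_shift[OF \<open>\<psi> \<in> L2\<close>, of c] by (auto simp: L2_def)
  have [measurable]: "(\<lambda>x. x) \<in> borel_measurable lebesgue"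
    by (rule measurable_completion) simp
  have cnj_meas [measurable]: "(\<lambda>x. cnj (g x)) \<in> borel_measurable lebesgue"
    if "g \<in> borel_measurable lebesgue" for g :: "real \<Rightarrow> complex"
    by (rule borel_measurable_continuous_on[OF _ that]) (intro continuous_intros)
  have v_meas [measurable]: "v p \<in> borel_measurable lebesgue" for p
    unfolding v_def by (cases p) simp
  have v_sq: "integrable lebesgue (\<lambda>x. (v p x)\<^sup>2)" for p
    unfolding v_def by (cases p) (simp add: power_mult_distrib shift_sq)
  have \<phi>_meas: "\<phi> p \<epsilon> \<in> borel_measurable lebesgue" if "\<epsilon> > 0" for p \<epsilon>
  proof (cases p)
    case (Pair n m)
    have "psi_ea a b L q0 \<psi> \<epsilon> n m = (\<lambda>x.
      cis (a \<epsilon> * gamma_mn b L q0 m n \<epsilon> + b \<epsilon> * beta_mn b L q0 m n \<epsilon> * exp (- \<epsilon> * x)) *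
      of_real (exp (- (1 / 2) * \<epsilon> * (of_int n * q0 + x))) * \<psi> (of_int n * q0 + x))"
      using psi_ea_eq[OF that] by blast
    also have "\<dots> \<in> borel_measurable lebesgue"
      unfolding cis_conv_exp by measurable
    finally show ?thesis by (simp add: \<phi>_def Pair)
  qed
  have h_meas [measurable]: "h p \<in> borel_measurable lebesgue" for p
  proof (cases p)
    case (Pair n m)
    have "psi_heis A B q0 p0 \<psi> n m = (\<lambda>x.
      cis (of_int m * p0 * (A * (of_int n * q0 / 2 + x) + B)) * \<psi> (of_int n * q0 + x))"
      using psi_heis_eq by blast
    also have "\<dots> \<in> borel_measurable lebesgue"
      unfolding cis_conv_exp by measurable
    finally show ?thesis by (simp add: h_def Pair)
  qed
  have \<phi>_bound: "AE x in lebesgue. norm (\<phi> p \<epsilon> x) \<le> v p x" if \<epsilon>: "\<epsilon> \<in> {0<..<1}" for p \<epsilon>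
  proof (cases p)
    case (Pair n m)
    have "AE x in lebesgue. of_int n * q0 + x \<notin> {-L..L} \<longrightarrow> \<psi> (of_int n * q0 + x) = 0"
      using assms(9) by (rule AE_lebesgue_shift)
    then show ?thesis
    proof eventually_elim
      case (elim x)
      show ?case
      proof (cases "\<psi> (of_int n * q0 + x) = 0")
        case False
        define y where "y = of_int n * q0 + x"
        have y: "- y \<le> L" using elim False by (auto simp: y_def)
        have "\<epsilon> * (- y) \<le> \<epsilon> * L" using \<epsilon> y by (intro mult_left_mono) auto
        also have "\<dots> \<le> 1 * L" using \<epsilon> L by (intro mult_right_mono) auto
        finally have "exp (- (1 / 2) * \<epsilon> * y) \<le> exp (L / 2)" by simp
        then show ?thesis
          using \<epsilon> by (simp add: Pair \<phi>_def v_def psi_ea_eq norm_mult y_def mult_right_mono)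
      qed (use \<epsilon> in \<open>simp add: Pair \<phi>_def v_def psi_ea_eq\<close>)
    qed
  qed
  \<comment> \<open>This holds at every \<open>x\<close>, with no exceptional null set: the value of
    \<open>\<psi>\<close> is a fixed factor, the weight tends to \<open>1\<close> and the phase
    converges.\<close>
  have \<phi>_lim: "((\<lambda>\<epsilon>. \<phi> p \<epsilon> x) \<longlongrightarrow> h p x) (at_right 0)" for p x
  proof (cases p)
    case (Pair n m)
    let ?\<theta> = "\<lambda>\<epsilon>. a \<epsilon> * gamma_mn b L q0 m n \<epsilon> + b \<epsilon> * beta_mn b L q0 m n \<epsilon> * exp (- \<epsilon> * x)"
    have "((\<lambda>\<epsilon>. exp (- (1 / 2) * \<epsilon> * (of_int n * q0 + x))) \<longlongrightarrow> 1) (at_right 0)"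
      by (auto intro!: tendsto_eq_intros)
    from tendsto_of_real[OF this]
    have Q: "((\<lambda>\<epsilon>. complex_of_real (exp (- (1 / 2) * \<epsilon> * (of_int n * q0 + x)))) \<longlongrightarrow> 1) (at_right 0)"
      by simp
    have "((\<lambda>\<epsilon>. cis (?\<theta> \<epsilon>) * of_real (exp (- (1 / 2) * \<epsilon> * (of_int n * q0 + x))) * \<psi> (of_int n * q0 + x))
      \<longlongrightarrow> cis (of_int m * p0 * (A * (of_int n * q0 / 2 + x) + B)) * 1 * \<psi> (of_int n * q0 + x)) (at_right 0)"
      unfolding \<open>p0 = _\<close>
      by (intro tendsto_mult tendsto_cis Q tendsto_const phase_tendsto[where ?a0.0 = a0 and ?b0.0 = b0] assms)
    moreover have "\<forall>\<^sub>F \<epsilon> in at_right 0.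
        cis (?\<theta> \<epsilon>) * of_real (exp (- (1 / 2) * \<epsilon> * (of_int n * q0 + x))) * \<psi> (of_int n * q0 + x) =
        \<phi> p \<epsilon> x"
      using eventually_at_right_less[of "0::real"]
      by eventually_elim (simp add: Pair \<phi>_def psi_ea_eq)
    ultimately show ?thesis
      by (simp add: Pair h_def psi_heis_eq tendsto_cong)
  qed
  have inner_lim: "((\<lambda>\<epsilon>. L2_inner (\<phi> p \<epsilon>) f) \<longlongrightarrow> L2_inner (h p) f) (at_right 0)" for p
    unfolding L2_inner_def
  proof (rule tendsto_integral_dominated_at_right)
    show "integrable lebesgue (\<lambda>x. v p x * norm (f x))"
      by (intro integrable_mult_of_square_integrable v_sq f2) measurable
    show "\<forall>\<^sub>F \<epsilon> in at_right 0. (\<lambda>x. cnj (\<phi> p \<epsilon> x) * f x) \<in> borel_measurable lebesgue \<and>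
        (AE x in lebesgue. norm (cnj (\<phi> p \<epsilon> x) * f x) \<le> v p x * norm (f x))"
      using eventually_at_right_real[OF zero_less_one]
    proof (eventually_elim, intro conjI)
      fix \<epsilon> :: real assume \<epsilon>: "\<epsilon> \<in> {0<..<1}"
      then have [measurable]: "\<phi> p \<epsilon> \<in> borel_measurable lebesgue" by (simp add: \<phi>_meas)
      show "(\<lambda>x. cnj (\<phi> p \<epsilon> x) * f x) \<in> borel_measurable lebesgue" by measurable
      show "AE x in lebesgue. norm (cnj (\<phi> p \<epsilon> x) * f x) \<le> v p x * norm (f x)"
        using \<phi>_bound[OF \<epsilon>, of p] by eventually_elim (simp add: norm_mult mult_right_mono)
    qed
    show "(\<lambda>x. cnj (h p x) * f x) \<in> borel_measurable lebesgue" by measurable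
    show "AE x in lebesgue. ((\<lambda>\<epsilon>. cnj (\<phi> p \<epsilon> x) * f x) \<longlongrightarrow> cnj (h p x) * f x) (at_right 0)"
      by (intro AE_I2 tendsto_mult tendsto_cnj \<phi>_lim tendsto_const)
  qed
  \<comment> \<open>This limit turns the affine normalisation into the Heisenberg one.\<close>
  have "((\<lambda>\<epsilon>. \<epsilon> / sinh (\<epsilon> * L)) \<longlongrightarrow> inverse L) (at_right 0)"
    using L by real_asymp
  from tendsto_mult_left[OF this, of "1 / (2 * chi)"]
  have "((\<lambda>\<epsilon>. \<epsilon> / (2 * chi * sinh (\<epsilon> * L))) \<longlongrightarrow> 1 / (2 * chi * L)) (at_right 0)"
    by (simp only: inverse_eq_divide times_divide_times_eq mult_1_left mult.assoc)
  then have C_lim: "(C p \<longlongrightarrow> D p) (at_right 0)" for p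
    using inner_lim[of p] unfolding C_def D_def \<phi>_def h_def
    by (cases p) (simp only: prod.case tendsto_mult tendsto_of_real)
  define S where "S = (\<lambda>\<epsilon> x. \<Sum>p\<in>?I. C p \<epsilon> * \<phi> p \<epsilon> x)"
  define T where "T = (\<lambda>x. \<Sum>p\<in>?I. D p * h p x)"
  have lim: "((\<lambda>\<epsilon>. S \<epsilon> x) \<longlongrightarrow> T x) (at_right 0)" for x
    unfolding S_def T_def by (intro tendsto_sum tendsto_mult C_lim \<phi>_lim)
  \<comment> \<open>Convergent coefficients are eventually bounded, and finiteness of
    \<open>?I\<close> makes this simultaneous in \<open>p\<close>. Combined with \<open>v\<close>,
    it gives a square-integrable bound on \<open>S \<epsilon>\<close> that is free of
    \<open>\<epsilon>\<close>.\<close>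
  have C_bound: "\<forall>\<^sub>F \<epsilon> in at_right 0. \<forall>p\<in>?I. norm (C p \<epsilon>) \<le> norm (D p) + 1"
  proof (intro eventually_ball_finite ballI)
    fix p
    have "\<forall>\<^sub>F \<epsilon> in at_right 0. norm (C p \<epsilon>) < norm (D p) + 1"
      by (rule order_tendstoD(2)[OF tendsto_norm[OF C_lim]]) simp
    then show "\<forall>\<^sub>F \<epsilon> in at_right 0. norm (C p \<epsilon>) \<le> norm (D p) + 1"
      by eventually_elim simp
  qed simp
  have "tendsto_L2 S T (at_right 0)"
  proof (rule tendsto_L2_dominated[OF _ _ _ lim])
    show "\<forall>\<^sub>F \<epsilon> in at_right 0. S \<epsilon> \<in> borel_measurable lebesgue \<and>
        (AE x in lebesgue. norm (S \<epsilon> x) \<le> (\<Sum>p\<in>?I. (norm (D p) + 1) * v p x))"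
      using C_bound eventually_at_right_real[OF zero_less_one]
    proof (eventually_elim, intro conjI)
      fix \<epsilon> :: real
      assume C: "\<forall>p\<in>?I. norm (C p \<epsilon>) \<le> norm (D p) + 1" and \<epsilon>: "\<epsilon> \<in> {0<..<1}"
      have [measurable]: "\<phi> p \<epsilon> \<in> borel_measurable lebesgue" for p
        using \<epsilon> by (simp add: \<phi>_meas)
      show "S \<epsilon> \<in> borel_measurable lebesgue"
        unfolding S_def by measurable
      have "AE x in lebesgue. \<forall>p\<in>?I. norm (\<phi> p \<epsilon> x) \<le> v p x"
        using \<phi>_bound[OF \<epsilon>] by (intro AE_finite_allI) auto
      then show "AE x in lebesgue. norm (S \<epsilon> x) \<le> (\<Sum>p\<in>?I. (norm (D p) + 1) * v p x)"
        by eventually_elim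
           (unfold S_def, intro sum_norm_le, use C in \<open>auto simp: norm_mult intro!: mult_mono\<close>)
    qed
    show "integrable lebesgue (\<lambda>x. (\<Sum>p\<in>?I. (norm (D p) + 1) * v p x)\<^sup>2)"
      by (rule square_integrable_sum) (auto simp: power_mult_distrib v_sq)
  qed measurable
  moreover have "S = (\<lambda>\<epsilon> x. \<Sum>n=N1..N2. \<Sum>m=M1..M2.
        of_real (\<epsilon> / (2 * chi * sinh (\<epsilon> * L))) *
          L2_inner (psi_ea a b L q0 \<psi> \<epsilon> n m) f * psi_ea a b L q0 \<psi> \<epsilon> n m x)"
    unfolding S_def C_def \<phi>_def sum.cartesian_product by (simp add: case_prod_beta)
  moreover have "T = (\<lambda>x. \<Sum>n=N1..N2. \<Sum>m=M1..M2.
        of_real (1 / (2 * chi * L)) *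
          L2_inner (psi_heis A B q0 p0 \<psi> n m) f * psi_heis A B q0 p0 \<psi> n m x)"
    unfolding T_def D_def h_def sum.cartesian_product by (simp add: case_prod_beta)
  ultimately show ?thesis
    using lim by (simp only: Let_def) blast
qed

end
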